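(* Let $n \geq 2$ be an integer and let $\mathbb{TT} \subset \mathbb{R}^n$ be the set of points all of whose $n$ Cartesian co-ordinates are transcendental. Then $\mathbb{R}^n \setminus \mathbb{TT}$, i.e. the set of points of $\mathbb{R}^n$ having at least one algebraic co-ordinate, remains continuous: for any two points $N, N' \in \mathbb{R}^n \setminus \mathbb{TT}$ there exists a continuous linear connection $l'$ of $N$ and $N'$ with $N, N' \in l' \subset \mathbb{R}^n \setminus \mathbb{TT}$.
   Context: A real number is algebraic if it is a root of a nonzero polynomial with rational coefficients, and transcendental otherwise. The co-ordinates are the standard Cartesian co-ordinates of $\mathbb{R}^n$. A "continuous linear connection" of $N$ and $N'$ means a continuous curve joining them (not necessarily a straight line), i.e. $l'$ is the image of a continuous map $\gamma:[0,1]\to\mathbb{R}^n$ with $\gamma(0)=N$ and $\gamma(1)=N'$. *)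

theory Defs
  imports "HOL-Analysis.Analysis" "HOL-Computational_Algebra.Polynomial"
begin

(* The library's "algebraic" uses integer coefficients; by algebraic_altdef this is
   the same as being a root of a nonzero polynomial with rational coefficients. *)
definition transcendental :: "real \<Rightarrow> bool"
  where "transcendental x \<longleftrightarrow> \<not> algebraic x"

definition TT :: "(real ^ 'n) set"
  where "TT = {x. \<forall>i. transcendental (x $ i)}"

(* The connection is the point set traced by the curve, not the parametrisation;
   "linear" means curve-like, not straight. *)
definition continuous_linear_connection ::
    "'a::topological_space set \<Rightarrow> 'a \<Rightarrow> 'a \<Rightarrow> bool"
  where "continuous_linear_connection l N N' \<longleftrightarrow>
    (\<exists>\<gamma>. path \<gamma> \<and> pathstart \<gamma> = N \<and> pathfinish \<gamma> = N' \<and> path_image \<gamma> = l)"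

end

theory Submission
  imports Defs
begin

text \<open>
  The complement of \<^const>\<open>TT\<close> is the union of the hyperplanes \<open>x $ i = a\<close> with \<open>a\<close> algebraic.
  Each hyperplane is convex, so points with a common algebraic coordinate are joined by a
  segment inside the union. Since 0 is algebraic, the coordinate hyperplanes through the
  origin are available to connect the others: a point \<open>N\<close> on \<open>x $ i = a\<close> moves within that
  hyperplane to the point where it meets the \<open>i\<close>-th axis, and this axis lies in \<open>x $ j = 0\<close>
  for any \<open>j \<noteq> i\<close>, so one continues along it to the origin. The second index \<open>j\<close> is where
  dimension at least 2 enters. Hence every point is connected to the origin
  (\<open>path_component_zero\<close>).
\<close>

lemma Compl_TT: "UNIV - TT = {x :: real ^ 'n. \<exists>i. algebraic (x $ i)}"
  by (auto simp: TT_def transcendental_def)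

lemma path_component_common_algebraic_coordinate:
  fixes x y :: "real ^ 'n"
  assumes "x $ i = y $ i" and "algebraic (x $ i)"
  shows "path_component (UNIV - TT) x y"
proof -
  have "closed_segment x y \<subseteq> {z. z $ i = x $ i}"
    using assms(1) by (auto simp: closed_segment_def) (simp add: algebra_simps)
  also have "\<dots> \<subseteq> UNIV - TT"
    unfolding Compl_TT using assms(2) by (metis (mono_tags, lifting) Collect_mono)
  finally show ?thesis
    unfolding path_component_def
    by (intro exI[of _ "linepath x y"]) auto
qed

lemma path_component_zero:
  fixes x :: "real ^ 'n"
  assumes "CARD('n) \<ge> 2" and "x \<in> UNIV - TT"
  shows "path_component (UNIV - TT) x 0"
proof -
  obtain i where i: "algebraic (x $ i)"
    using assms(2) by (auto simp: Compl_TT)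
  obtain j :: 'n where j: "j \<noteq> i"
  proof -
    have "UNIV \<noteq> {i}"
    proof
      assume "UNIV = {i}"
      then have "CARD('n) = card {i}" by (rule arg_cong)
      with assms(1) show False by simp
    qed
    then show thesis using that by auto
  qed
  have "path_component (UNIV - TT) x (axis i (x $ i))"
    by (rule path_component_common_algebraic_coordinate[of _ i]) (auto simp: i axis_def)
  moreover have "path_component (UNIV - TT) (axis i (x $ i)) 0"
    by (rule path_component_common_algebraic_coordinate[of _ j]) (auto simp: j axis_def)
  ultimately show ?thesis
    by (rule path_component_trans)
qed

theorem mainTheorem1:
  assumes "CARD('n::finite) \<ge> 2"
  shows "UNIV - TT = {x :: real ^ 'n. \<exists>i. algebraic (x $ i)} \<and>
    (\<forall>N \<in> UNIV - TT. \<forall>N' \<in> UNIV - (TT :: (real ^ 'n) set).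
      \<exists>l'. continuous_linear_connection l' N N' \<and>
        N \<in> l' \<and> N' \<in> l' \<and> l' \<subseteq> UNIV - TT)"
proof (intro conjI ballI Compl_TT)
  fix N N' :: "real ^ 'n"
  assume "N \<in> UNIV - TT" and "N' \<in> UNIV - TT"
  then have "path_component (UNIV - TT) N N'"
    by (meson assms path_component_zero path_component_sym path_component_trans)
  then obtain g where "path g" "path_image g \<subseteq> UNIV - TT" "pathstart g = N" "pathfinish g = N'"
    unfolding path_component_def by blast
  then show "\<exists>l'. continuous_linear_connection l' N N' \<and>
      N \<in> l' \<and> N' \<in> l' \<and> l' \<subseteq> UNIV - TT"
    unfolding continuous_linear_connection_def
    by (intro exI[of _ "path_image g"]) auto
qed

end
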